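(* Consider the problem $(\mathcal{P}_2)$: maximize $f(\boldsymbol{\theta})$ over $\boldsymbol{\theta}\in\mathcal{C}$ subject to $u_k(\boldsymbol{\theta})\ge S_{\mathrm{o},k}$ for all $k=1,\dots,K$, assumed feasible, together with its penalized versions $\max_{\boldsymbol{\theta}\in\mathcal{C}} f_{\xi}(\boldsymbol{\theta})$, $\xi>0$ (all objects are defined in the context). Then the following hold. (i) Fix $\xi>0$ and let $\{\boldsymbol{\theta}^{(n)}\}_{n\ge 1}$ be the sequence generated by the accelerated projected gradient (APG) iterations described in the context, with step sizes $0<\alpha_\theta,\alpha_y<1/L_f$. Then the objective sequence $\{f_{\xi}(\boldsymbol{\theta}^{(n)})\}$ is monotonically increasing (i.e. non-decreasing), the sequence $\{\boldsymbol{\theta}^{(n)}\}$ is bounded and hence has accumulation points, and each accumulation point is a stationary solution of $\max_{\boldsymbol{\theta}\in\mathcal{C}} f_\xi(\boldsymbol{\theta})$. (ii) Let $\xi_1>0$, $\rho>1$, $\xi_{j+1}=\rho\,\xi_j$ (so $\xi_j\to\infty$), and let $\boldsymbol{\theta}_{\xi_j}$ denote an optimal solution of $\max_{\boldsymbol{\theta}\in\mathcal{C}} f_{\xi_j}(\boldsymbol{\theta})$. Then, as $j\to\infty$, the sequence $\{\boldsymbol{\theta}_{\xi_j}\}$ converges, in the subsequence sense, to a feasible point of $(\mathcal{P}_2)$ (that is, it has convergent subsequences and their limits are feasible for $(\mathcal{P}_2)$), and the solution so obtained is a stationary point of $(\mathcal{P}_2)$.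
   Context: Data. $M,K,N\ge1$ are integers (numbers of access points, users, antennas per access point); $\rho_{\mathrm d},\rho_{\mathrm p},N_0,B,\bar P_{\mathrm{fix}}>0$; $\tau_{\mathrm p}$ is a positive integer and $\tau_{\mathrm c}>\tau_{\mathrm p}$; $0<\alpha_m\le1$ for $m=1,\dots,M$; $\beta_{mk}>0$; $\boldsymbol{\varphi}_k\in\mathbb{C}^{\tau_{\mathrm p}}$ with $\|\boldsymbol{\varphi}_k\|=1$; $S_{\mathrm o,k}\ge0$; and $\gamma_{mk}=\dfrac{\tau_{\mathrm p}\rho_{\mathrm p}\beta_{mk}^2}{\tau_{\mathrm p}\rho_{\mathrm p}\sum_{k'=1}^K\beta_{mk'}|\boldsymbol{\varphi}_{k'}^H\boldsymbol{\varphi}_k|^2+1}$. Variables: $\boldsymbol{\theta}=(\boldsymbol{\theta}_1;\dots;\boldsymbol{\theta}_M)\in\mathbb{R}^{MK}$ with $\boldsymbol{\theta}_m=[\theta_{m1};\dots;\theta_{mK}]\in\mathbb{R}^K$. $\mathbf{A}_k=\mathbf{I}_M\otimes\mathbf{e}_k^T$ with $\mathbf{e}_k$ the $k$-th unit vector of $\mathbb{R}^K$, so $\mathbf{A}_k\boldsymbol{\theta}=[\theta_{1k};\dots;\theta_{Mk}]$. $\tilde{\boldsymbol{\gamma}}_{k'k}=|\boldsymbol{\varphi}_{k'}^H\boldsymbol{\varphi}_k|\big[\sqrt{\gamma_{1k'}}\tfrac{\beta_{1k}}{\beta_{1k'}};\dots;\sqrt{\gamma_{Mk'}}\tfrac{\beta_{Mk}}{\beta_{Mk'}}\big]\in\mathbb{R}^M$,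 $\tilde{\boldsymbol{\kappa}}_k=[\sqrt{\beta_{1k}};\dots;\sqrt{\beta_{Mk}}]\in\mathbb{R}^M$. $\odot$ is the entrywise product, $\otimes$ the Kronecker product, $\|\cdot\|$ the Euclidean norm. Functions: $\mathcal{C}=\{\boldsymbol{\theta}\in\mathbb{R}^{MK}:\|\boldsymbol{\theta}_m\|^2\le 1/N,\ m=1,\dots,M;\ \boldsymbol{\theta}\ge0\}$ (entrywise inequality); $d_k(\boldsymbol{\theta})=\rho_{\mathrm d}N^2\sum_{k'\ne k}(\tilde{\boldsymbol{\gamma}}_{k'k}^T\mathbf{A}_{k'}\boldsymbol{\theta})^2+\rho_{\mathrm d}N\sum_{k'=1}^K\|\tilde{\boldsymbol{\kappa}}_k\odot(\mathbf{A}_{k'}\boldsymbol{\theta})\|^2+1$; $u_k(\boldsymbol{\theta})=\frac{\tau_{\mathrm c}-\tau_{\mathrm p}}{\tau_{\mathrm c}}\log_2\big(1+\rho_{\mathrm d}N^2(\tilde{\boldsymbol{\gamma}}_{kk}^T\mathbf{A}_k\boldsymbol{\theta})^2/d_k(\boldsymbol{\theta})\big)$; $u=\sum_{k=1}^Ku_k$; $v(\boldsymbol{\theta})=\bar P_{\mathrm{fix}}+\rho_{\mathrm d}N_0N\sum_{m=1}^M\frac1{\alpha_m}\|\boldsymbol{\theta}_m\|^2$; $f=B\,u/v$; $a_k=\sqrt{(2^{S_{\mathrm o,k}\tau_{\mathrm c}/(\tau_{\mathrm c}-\tau_{\mathrm p})}-1)/(\rho_{\mathrm d}N^2)}$; $g_k(\boldsymbol{\theta})=a_k\sqrt{d_k(\boldsymbol{\theta})}-\tilde{\boldsymbol{\gamma}}_{kk}^T\mathbf{A}_k\boldsymbol{\theta}$;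 $\Psi_k=[\max(0,g_k)]^2$; $f_\xi=f-\xi\sum_{k=1}^K\Psi_k$. For $\boldsymbol\theta\in\mathcal C$ the constraint $u_k(\boldsymbol{\theta})\ge S_{\mathrm o,k}$ is equivalent to $g_k(\boldsymbol{\theta})\le0$. $L_f$ denotes a Lipschitz constant of $\nabla f_\xi$. APG iterations for fixed $\xi$: let $P_{\mathcal{C}}$ be the Euclidean projection onto $\mathcal{C}$; start from $\boldsymbol{\theta}^{(0)}\in\mathbb{R}_+^{MK}$, $\boldsymbol{\theta}^{(1)}=\mathbf{z}^{(1)}=\boldsymbol{\theta}^{(0)}$, $t^{(1)}=t^{(0)}=1$; for $n=1,2,\dots$: $\mathbf{y}^{(n)}=\boldsymbol{\theta}^{(n)}+\frac{t^{(n-1)}}{t^{(n)}}(\mathbf{z}^{(n)}-\boldsymbol{\theta}^{(n)})+\frac{t^{(n-1)}-1}{t^{(n)}}(\boldsymbol{\theta}^{(n)}-\boldsymbol{\theta}^{(n-1)})$; $\mathbf{z}^{(n+1)}=P_{\mathcal{C}}(\mathbf{y}^{(n)}+\alpha_y\nabla f_\xi(\mathbf{y}^{(n)}))$; $\mathbf{v}^{(n+1)}=P_{\mathcal{C}}(\boldsymbol{\theta}^{(n)}+\alpha_\theta\nabla f_\xi(\boldsymbol{\theta}^{(n)}))$; $\boldsymbol{\theta}^{(n+1)}=\mathbf{z}^{(n+1)}$ if $f_\xi(\mathbf{z}^{(n+1)})\ge f_\xi(\mathbf{v}^{(n+1)})$ and $\boldsymbol{\theta}^{(n+1)}=\mathbf{v}^{(n+1)}$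 otherwise; $t^{(n+1)}=\frac{\sqrt{4(t^{(n)})^2+1}+1}{2}$. A point $\boldsymbol{\theta}^*$ of a convex set $\mathcal{F}$ is stationary for maximizing a differentiable $F$ over $\mathcal{F}$ if $\langle\nabla F(\boldsymbol{\theta}^* ),\boldsymbol{\theta}-\boldsymbol{\theta}^*\rangle\le0$ for all $\boldsymbol{\theta}\in\mathcal{F}$. For the penalized problem $F=f_\xi$, $\mathcal{F}=\mathcal{C}$; for $(\mathcal{P}_2)$, $F=f$ and $\mathcal{F}=\{\boldsymbol{\theta}\in\mathcal{C}:g_k(\boldsymbol{\theta})\le0\ \forall k\}$, which is convex.
   Formalization: Monotonicity of the objective sequence is stated from n=1 when the starting point lies in C, and from n=2 for an arbitrary nonnegative start; a start outside C can have a larger objective value than the next iterate, so the claim from n=1 fails there. *)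

theory Defs
  imports "HOL-Analysis.Analysis"
begin

section \<open>Gradient, stationary points, accumulation points\<close>

definition grad :: "('a::real_inner \<Rightarrow> real) \<Rightarrow> 'a \<Rightarrow> 'a" where
  "grad F x = (THE D. GDERIV F x :> D)"

definition stationary_max :: "('a::real_inner \<Rightarrow> real) \<Rightarrow> 'a set \<Rightarrow> 'a \<Rightarrow> bool" where
  "stationary_max F S x \<longleftrightarrow>
     x \<in> S \<and> F differentiable (at x) \<and> (\<forall>y\<in>S. inner (grad F x) (y - x) \<le> 0)"

definition accumulation_point :: "(nat \<Rightarrow> 'a::topological_space) \<Rightarrow> 'a \<Rightarrow> bool" where
  "accumulation_point X x \<longleftrightarrow> (\<exists>r::nat \<Rightarrow> nat. strict_mono r \<and> (X \<circ> r) \<longlonglongrightarrow> x)"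

section \<open>System data\<close>

text \<open>Access points are indexed by \<open>'m\<close>, users by \<open>'k\<close>, pilot coordinates by \<open>'p\<close>, so that
  \<open>M = CARD('m)\<close>, \<open>K = CARD('k)\<close> and \<open>\<tau>\<^sub>p = CARD('p)\<close> are arbitrary positive integers.
  The variable \<open>\<theta>\<close> of dimension \<open>M * K\<close> is stored blockwise as \<open>\<theta> :: real^'k^'m\<close>, with \<open>\<theta> $ m\<close> the block
  of access point \<open>m\<close>; the norm and inner product of this type are the Euclidean ones
  of dimension \<open>M * K\<close>.\<close>

record ('m, 'k, 'p::finite) cf_system =
  nAnt :: nat                               \<comment> \<open>\<open>N\<close>\<close>
  rhoD :: real
  rhoP :: real
  noise :: real                             \<comment> \<open>\<open>N\<^sub>0\<close>\<close>
  bandw :: real                             \<comment> \<open>\<open>B\<close>\<close>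
  pFix :: real
  tauC :: real
  ampEff :: "'m \<Rightarrow> real"                    \<comment> \<open>\<open>\<alpha>\<^sub>m\<close>\<close>
  beta :: "'m \<Rightarrow> 'k \<Rightarrow> real"
  pilot :: "'k \<Rightarrow> complex ^ 'p"             \<comment> \<open>\<open>\<phi>\<^sub>k\<close>\<close>
  seMin :: "'k \<Rightarrow> real"                     \<comment> \<open>\<open>S\<close> with index \<open>o,k\<close>\<close>

definition tauP :: "('m, 'k, 'p::finite) cf_system \<Rightarrow> real" where
  "tauP D = real CARD('p)"

definition valid_system :: "('m, 'k, 'p::finite) cf_system \<Rightarrow> bool" where
  "valid_system D \<longleftrightarrow>
     nAnt D \<ge> 1 \<and> rhoD D > 0 \<and> rhoP D > 0 \<and> noise D > 0 \<and> bandw D > 0 \<and> pFix D > 0 \<and>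
     tauC D > tauP D \<and>
     (\<forall>m. 0 < ampEff D m \<and> ampEff D m \<le> 1) \<and>
     (\<forall>m k. beta D m k > 0) \<and>
     (\<forall>k. norm (pilot D k) = 1) \<and>
     (\<forall>k. seMin D k \<ge> 0)"

definition pilot_corr :: "('m, 'k, 'p::finite) cf_system \<Rightarrow> 'k \<Rightarrow> 'k \<Rightarrow> real" where
  "pilot_corr D k' k = cmod (\<Sum>i\<in>UNIV. cnj (pilot D k' $ i) * pilot D k $ i)"

definition gamma :: "('m, 'k::finite, 'p::finite) cf_system \<Rightarrow> 'm \<Rightarrow> 'k \<Rightarrow> real" where
  "gamma D m k = tauP D * rhoP D * (beta D m k)\<^sup>2 /
     (tauP D * rhoP D * (\<Sum>k'\<in>UNIV. beta D m k' * (pilot_corr D k' k)\<^sup>2) + 1)"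

section \<open>The functions of the problem\<close>

text \<open>The product of the matrix \<open>A\<^sub>k\<close>, the Kronecker product of the identity with the transposed
  \<open>k\<close>-th unit vector, with \<open>\<theta>\<close>.\<close>
definition Amap :: "'k \<Rightarrow> real ^ 'k ^ 'm \<Rightarrow> real ^ 'm" where
  "Amap k \<theta> = (\<chi> m. \<theta> $ m $ k)"

definition gamma_tilde ::
  "('m::finite, 'k::finite, 'p::finite) cf_system \<Rightarrow> 'k \<Rightarrow> 'k \<Rightarrow> real ^ 'm" where
  "gamma_tilde D k' k =
     pilot_corr D k' k *\<^sub>R (\<chi> m. sqrt (gamma D m k') * (beta D m k / beta D m k'))"

definition kappa_tilde :: "('m::finite, 'k, 'p::finite) cf_system \<Rightarrow> 'k \<Rightarrow> real ^ 'm" where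
  "kappa_tilde D k = (\<chi> m. sqrt (beta D m k))"

definition Cset :: "('m::finite, 'k::finite, 'p::finite) cf_system \<Rightarrow> (real ^ 'k ^ 'm) set" where
  "Cset D = {\<theta>. (\<forall>m. (norm (\<theta> $ m))\<^sup>2 \<le> 1 / real (nAnt D)) \<and> (\<forall>m k. 0 \<le> \<theta> $ m $ k)}"

text \<open>Multiplication on \<open>real ^ 'm\<close> is entrywise.\<close>
definition dfun ::
  "('m::finite, 'k::finite, 'p::finite) cf_system \<Rightarrow> 'k \<Rightarrow> real ^ 'k ^ 'm \<Rightarrow> real" where
  "dfun D k \<theta> =
     rhoD D * (real (nAnt D))\<^sup>2 *
       (\<Sum>k'\<in>UNIV - {k}. (inner (gamma_tilde D k' k) (Amap k' \<theta>))\<^sup>2)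
     + rhoD D * real (nAnt D) * (\<Sum>k'\<in>UNIV. (norm (kappa_tilde D k * Amap k' \<theta>))\<^sup>2)
     + 1"

definition ufun ::
  "('m::finite, 'k::finite, 'p::finite) cf_system \<Rightarrow> 'k \<Rightarrow> real ^ 'k ^ 'm \<Rightarrow> real" where
  "ufun D k \<theta> = (tauC D - tauP D) / tauC D *
     log 2 (1 + rhoD D * (real (nAnt D))\<^sup>2 * (inner (gamma_tilde D k k) (Amap k \<theta>))\<^sup>2
                / dfun D k \<theta>)"

definition vfun :: "('m::finite, 'k::finite, 'p::finite) cf_system \<Rightarrow> real ^ 'k ^ 'm \<Rightarrow> real" where
  "vfun D \<theta> = pFix D + rhoD D * noise D * real (nAnt D) *
     (\<Sum>m\<in>UNIV. 1 / ampEff D m * (norm (\<theta> $ m))\<^sup>2)"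

definition ffun :: "('m::finite, 'k::finite, 'p::finite) cf_system \<Rightarrow> real ^ 'k ^ 'm \<Rightarrow> real" where
  "ffun D \<theta> = bandw D * (\<Sum>k\<in>UNIV. ufun D k \<theta>) / vfun D \<theta>"

definition acoef :: "('m, 'k, 'p::finite) cf_system \<Rightarrow> 'k \<Rightarrow> real" where
  "acoef D k = sqrt ((2 powr (seMin D k * tauC D / (tauC D - tauP D)) - 1)
                     / (rhoD D * (real (nAnt D))\<^sup>2))"

definition gfun ::
  "('m::finite, 'k::finite, 'p::finite) cf_system \<Rightarrow> 'k \<Rightarrow> real ^ 'k ^ 'm \<Rightarrow> real" where
  "gfun D k \<theta> = acoef D k * sqrt (dfun D k \<theta>) - inner (gamma_tilde D k k) (Amap k \<theta>)"

definition Psi ::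
  "('m::finite, 'k::finite, 'p::finite) cf_system \<Rightarrow> 'k \<Rightarrow> real ^ 'k ^ 'm \<Rightarrow> real" where
  "Psi D k \<theta> = (max 0 (gfun D k \<theta>))\<^sup>2"

definition f_pen ::
  "('m::finite, 'k::finite, 'p::finite) cf_system \<Rightarrow> real \<Rightarrow> real ^ 'k ^ 'm \<Rightarrow> real" where
  "f_pen D \<xi> \<theta> = ffun D \<theta> - \<xi> * (\<Sum>k\<in>UNIV. Psi D k \<theta>)"

definition feasible_P2 ::
  "('m::finite, 'k::finite, 'p::finite) cf_system \<Rightarrow> (real ^ 'k ^ 'm) set" where
  "feasible_P2 D = {\<theta> \<in> Cset D. \<forall>k. ufun D k \<theta> \<ge> seMin D k}"

text \<open>The convex description of the feasible set, over which stationarity is defined.\<close>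
definition feasible_P2_conv ::
  "('m::finite, 'k::finite, 'p::finite) cf_system \<Rightarrow> (real ^ 'k ^ 'm) set" where
  "feasible_P2_conv D = {\<theta> \<in> Cset D. \<forall>k. gfun D k \<theta> \<le> 0}"

definition optimal_max :: "('a \<Rightarrow> real) \<Rightarrow> 'a set \<Rightarrow> 'a \<Rightarrow> bool" where
  "optimal_max F S x \<longleftrightarrow> x \<in> S \<and> (\<forall>y\<in>S. F y \<le> F x)"

section \<open>Accelerated projected gradient iterations\<close>

text \<open>The entries \<open>z 0\<close>, \<open>y 0\<close>, \<open>v 0\<close>, \<open>v 1\<close> play no role and are left unconstrained.
  The initial point is entrywise nonnegative but need not lie in \<open>C\<close>. If it does not, then
  \<open>\<theta> 1 = \<theta> 0\<close> may have a larger objective value than \<open>\<theta> 2\<close>, which lies in \<open>C\<close>.\<close>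
definition apg_iterates ::
  "(real ^ 'k::finite ^ 'm::finite \<Rightarrow> real) \<Rightarrow> (real ^ 'k ^ 'm) set \<Rightarrow> real \<Rightarrow> real \<Rightarrow>
   (nat \<Rightarrow> real ^ 'k ^ 'm) \<Rightarrow> (nat \<Rightarrow> real ^ 'k ^ 'm) \<Rightarrow> (nat \<Rightarrow> real ^ 'k ^ 'm) \<Rightarrow>
   (nat \<Rightarrow> real ^ 'k ^ 'm) \<Rightarrow> (nat \<Rightarrow> real) \<Rightarrow> bool" where
  "apg_iterates F C \<alpha>\<^sub>\<theta> \<alpha>\<^sub>y \<theta> z y v t \<longleftrightarrow>
     (\<forall>m k. 0 \<le> \<theta> 0 $ m $ k) \<and> \<theta> 1 = \<theta> 0 \<and> z 1 = \<theta> 0 \<and> t 0 = 1 \<and> t 1 = 1 \<and>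
     (\<forall>n\<ge>1.
        y n = \<theta> n + (t (n - 1) / t n) *\<^sub>R (z n - \<theta> n)
                  + ((t (n - 1) - 1) / t n) *\<^sub>R (\<theta> n - \<theta> (n - 1)) \<and>
        z (n + 1) = closest_point C (y n + \<alpha>\<^sub>y *\<^sub>R grad F (y n)) \<and>
        v (n + 1) = closest_point C (\<theta> n + \<alpha>\<^sub>\<theta> *\<^sub>R grad F (\<theta> n)) \<and>
        \<theta> (n + 1) = (if F (z (n + 1)) \<ge> F (v (n + 1)) then z (n + 1) else v (n + 1)) \<and>
        t (n + 1) = (sqrt (4 * (t n)\<^sup>2 + 1) + 1) / 2)"

end

theory Submission
  imports Defs
begin

text \<open>(i) Since \<open>\<theta>\<^sup>(\<^sup>n\<^sup>+\<^sup>1\<^sup>)\<close> is at least as good as the plain projected gradient step \<open>v\<^sup>(\<^sup>n\<^sup>+\<^sup>1\<^sup>)\<close>, the extrapolated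
  points never matter: the descent lemma gives
  \<open>F (\<theta>\<^sup>(\<^sup>n\<^sup>+\<^sup>1\<^sup>)) \<ge> F (\<theta>\<^sup>(\<^sup>n\<^sup>)) + L/2 * \<parallel>v\<^sup>(\<^sup>n\<^sup>+\<^sup>1\<^sup>) - \<theta>\<^sup>(\<^sup>n\<^sup>)\<parallel>\<^sup>2\<close> on \<open>C\<close>. As \<open>F\<close> is bounded on the compact set
  \<open>C\<close>, the residuals vanish, so every accumulation point is a fixed point of the projected
  gradient map, i.e. a stationary point.

  (ii) Comparing with feasible points, \<open>\<xi>\<^sub>j * \<Sum>\<^sub>k \<Psi>\<^sub>k (\<theta>\<^sub>j)\<close> is bounded, so limits are feasible, and
  \<open>f (\<theta>\<^sub>j) \<ge> f (y)\<close> for feasible \<open>y\<close>, so limits are even global maximizers of \<open>f\<close>. The square root of \<open>d\<^sub>k\<close>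
  is a Euclidean norm of an affine map, hence the feasible set is convex and maximizers are
  stationary; no constraint qualification enters.\<close>

section \<open>Gradients and first-order conditions\<close>

lemma gderiv_unique:
  assumes "GDERIV F x :> D" "GDERIV F x :> D'"
  shows "D = D'"
proof -
  have "inner h D = inner h D'" for h
    using has_derivative_unique[OF assms[unfolded gderiv_def]] by (rule fun_cong)
  then show ?thesis by (rule vector_eq_ldot[THEN iffD1, OF allI])
qed

lemma gderiv_grad:
  fixes F :: "'a::euclidean_space \<Rightarrow> real"
  assumes "F differentiable (at x)"
  shows "GDERIV F x :> grad F x"
proof -
  obtain F' where F': "(F has_derivative F') (at x)"
    using assms differentiable_def by blast
  have "F' = (\<lambda>h. inner h (adjoint F' 1))"
    using adjoint_works[OF has_derivative_linear[OF F'], of _ 1] by (auto simp: fun_eq_iff)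
  then have D: "GDERIV F x :> adjoint F' 1"
    using F' unfolding gderiv_def by metis
  show ?thesis
    unfolding grad_def by (rule theI[of _ "adjoint F' 1"]) (fact D, rule gderiv_unique[OF _ D])
qed

lemma has_real_derivative_along_line:
  fixes F :: "'a::euclidean_space \<Rightarrow> real"
  assumes "F differentiable (at (x + s *\<^sub>R h))"
  shows "((\<lambda>s. F (x + s *\<^sub>R h)) has_real_derivative inner (grad F (x + s *\<^sub>R h)) h) (at s)"
proof -
  have "(F has_derivative (\<lambda>h'. inner h' (grad F (x + s *\<^sub>R h)))) (at (x + s *\<^sub>R h))"
    using gderiv_grad[OF assms] by (simp add: gderiv_def)
  moreover have "((\<lambda>s. x + s *\<^sub>R h) has_derivative (\<lambda>s. s *\<^sub>R h)) (at s)"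
    by (auto intro!: derivative_eq_intros)
  ultimately have "((\<lambda>s. F (x + s *\<^sub>R h)) has_derivative (\<lambda>s'. inner (s' *\<^sub>R h) (grad F (x + s *\<^sub>R h)))) (at s)"
    by (rule has_derivative_compose[rotated])
  then show ?thesis
    by (simp add: has_field_derivative_def inner_commute mult_commute_abs)
qed

lemma lipschitz_grad_lower_bound:
  fixes F :: "'a::euclidean_space \<Rightarrow> real"
  assumes diff: "\<And>x. F differentiable (at x)" and lip: "L-lipschitz_on UNIV (grad F)"
  shows "F x + inner (grad F x) (y - x) - L / 2 * (norm (y - x))\<^sup>2 \<le> F y"
proof -
  define h where "h = y - x"
  define \<phi> where "\<phi> s = F (x + s *\<^sub>R h) + L / 2 * s\<^sup>2 * (norm h)\<^sup>2 - s * inner (grad F x) h" for s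
  have "\<phi> 0 \<le> \<phi> 1"
  proof (rule DERIV_nonneg_imp_nondecreasing[of 0 1 \<phi>])
    fix s :: real assume s: "0 \<le> s" "s \<le> 1"
    let ?D = "inner (grad F (x + s *\<^sub>R h)) h + L * s * (norm h)\<^sup>2 - inner (grad F x) h"
    have "DERIV \<phi> s :> ?D"
      unfolding \<phi>_def
      by (rule derivative_eq_intros has_real_derivative_along_line diff refl | simp)+
    moreover have "norm (grad F (x + s *\<^sub>R h) - grad F x) \<le> L * (s * norm h)"
      using lipschitz_onD[OF lip, of "x + s *\<^sub>R h" x] s by (simp add: dist_norm)
    then have "norm (grad F (x + s *\<^sub>R h) - grad F x) * norm h \<le> L * (s * norm h) * norm h"
      by (simp add: mult_right_mono)
    then have "- inner (grad F (x + s *\<^sub>R h) - grad F x) h \<le> L * s * (norm h)\<^sup>2"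
      using Cauchy_Schwarz_ineq2[of "grad F (x + s *\<^sub>R h) - grad F x" h]
      by (simp add: power2_eq_square algebra_simps)
    then have "0 \<le> ?D" by (simp add: inner_diff_left)
    ultimately show "\<exists>y. DERIV \<phi> s :> y \<and> 0 \<le> y" by blast
  qed simp
  then show ?thesis by (simp add: \<phi>_def h_def)
qed

lemma optimal_max_imp_stationary_max:
  fixes F :: "'a::euclidean_space \<Rightarrow> real"
  assumes "convex S" and opt: "optimal_max F S x" and diff: "F differentiable (at x)"
  shows "stationary_max F S x"
  unfolding stationary_max_def
proof (intro conjI ballI)
  show "x \<in> S" using opt by (simp add: optimal_max_def)
  fix y assume y: "y \<in> S"
  show "inner (grad F x) (y - x) \<le> 0"
  proof (rule ccontr)
    assume "\<not> ?thesis"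
    then have "0 < inner (grad F x) (y - x)" by simp
    moreover have "((\<lambda>s. F (x + s *\<^sub>R (y - x))) has_real_derivative inner (grad F x) (y - x)) (at 0)"
      using has_real_derivative_along_line[of F x 0 "y - x"] diff by simp
    ultimately obtain d where d: "d > 0" "\<And>s. 0 < s \<Longrightarrow> s < d \<Longrightarrow> F x < F (x + s *\<^sub>R (y - x))"
      using DERIV_pos_inc_right by fastforce
    define s where "s = min 1 (d / 2)"
    have s: "0 < s" "s < d" "s \<le> 1" using d(1) by (auto simp: s_def)
    have "x + s *\<^sub>R (y - x) = (1 - s) *\<^sub>R x + s *\<^sub>R y" by (simp add: algebra_simps)
    also have "\<dots> \<in> S"
      using \<open>convex S\<close> \<open>x \<in> S\<close> y s by (simp add: convexD_alt)
    finally show False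
      using d(2)[of s] s opt by (auto simp: optimal_max_def not_less[symmetric])
  qed
qed (rule diff)

section \<open>Projected gradient steps\<close>

lemma projected_gradient_variational:
  fixes F :: "'a::euclidean_space \<Rightarrow> real"
  assumes "convex C" "closed C" "y \<in> C" and v: "v = closest_point C (x + \<alpha> *\<^sub>R grad F x)"
  shows "inner (x + \<alpha> *\<^sub>R grad F x - v) (y - v) \<le> 0"
  unfolding v by (rule closest_point_dot[OF assms(1-3)])

lemma projected_gradient_ascent:
  fixes F :: "'a::euclidean_space \<Rightarrow> real"
  assumes diff: "\<And>x. F differentiable (at x)" and lip: "L-lipschitz_on UNIV (grad F)"
    and C: "convex C" "closed C" and x: "x \<in> C"
    and \<alpha>: "0 < \<alpha>" "\<alpha> < 1 / L" and "L > 0"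
    and v: "v = closest_point C (x + \<alpha> *\<^sub>R grad F x)"
  shows "F x + L / 2 * (norm (v - x))\<^sup>2 \<le> F v"
proof -
  have "inner (x + \<alpha> *\<^sub>R grad F x - v) (x - v) \<le> 0"
    by (rule projected_gradient_variational[OF C x v])
  then have "(norm (v - x))\<^sup>2 \<le> \<alpha> * inner (grad F x) (v - x)"
    by (simp add: power2_norm_eq_inner algebra_simps inner_commute)
  then have "(norm (v - x))\<^sup>2 / \<alpha> \<le> inner (grad F x) (v - x)"
    using \<alpha> by (simp add: field_simps)
  moreover have "L \<le> 1 / \<alpha>" using \<alpha> \<open>L > 0\<close> by (simp add: field_simps)
  then have "L * (norm (v - x))\<^sup>2 \<le> (norm (v - x))\<^sup>2 / \<alpha>"
    using mult_right_mono[of L "1 / \<alpha>" "(norm (v - x))\<^sup>2"] by simp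
  ultimately show ?thesis
    using lipschitz_grad_lower_bound[OF diff lip, of x v] by simp
qed

lemma projected_gradient_fixed_imp_stationary_max:
  fixes F :: "'a::euclidean_space \<Rightarrow> real"
  assumes "convex C" "closed C" "x \<in> C" "0 < \<alpha>" "F differentiable (at x)"
    and fixp: "closest_point C (x + \<alpha> *\<^sub>R grad F x) = x"
  shows "stationary_max F C x"
  unfolding stationary_max_def
proof (intro conjI ballI)
  fix y assume "y \<in> C"
  then have "\<alpha> * inner (grad F x) (y - x) \<le> 0"
    using projected_gradient_variational[OF assms(1,2) \<open>y \<in> C\<close> fixp[symmetric]] by simp
  then show "inner (grad F x) (y - x) \<le> 0"
    using \<open>0 < \<alpha>\<close> by (simp add: mult_le_0_iff)
qed (use assms in auto)

lemma accumulation_point_exists: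
  fixes X :: "nat \<Rightarrow> 'a::metric_space"
  assumes "compact C" "\<And>n. n \<ge> n0 \<Longrightarrow> X n \<in> C"
  shows "\<exists>x. accumulation_point X x"
proof -
  have "\<forall>n. X (n + n0) \<in> C" using assms(2) by simp
  then obtain x r where r: "strict_mono (r :: nat \<Rightarrow> nat)" "((\<lambda>n. X (n + n0)) \<circ> r) \<longlonglongrightarrow> x"
    using seq_compactE[OF assms(1)[unfolded compact_eq_seq_compact_metric]] by metis
  then have "strict_mono (\<lambda>n. r n + n0)" "(X \<circ> (\<lambda>n. r n + n0)) \<longlonglongrightarrow> x"
    by (auto simp: strict_mono_def o_def)
  then show ?thesis unfolding accumulation_point_def by blast
qed

lemma accumulation_point_in_closed:
  fixes X :: "nat \<Rightarrow> 'a::metric_space"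
  assumes "closed C" "\<And>n. n \<ge> n0 \<Longrightarrow> X n \<in> C" "strict_mono r" "(X \<circ> r) \<longlonglongrightarrow> x"
  shows "x \<in> C"
proof (rule Lim_in_closed_set[OF assms(1) _ _ assms(4)])
  show "\<forall>\<^sub>F n in sequentially. (X \<circ> r) n \<in> C"
    unfolding eventually_sequentially o_def
    using assms(2) seq_suble[OF assms(3)] order_trans by meson
qed simp

lemma apg_iterates_step:
  fixes F :: "real ^ 'k::finite ^ 'm::finite \<Rightarrow> real"
  assumes apg: "apg_iterates F C \<alpha>\<^sub>\<theta> \<alpha>\<^sub>y \<theta> z y v t"
    and C: "closed C" "C \<noteq> {}" and "n \<ge> 1"
  shows "\<theta> (n + 1) \<in> C" "F (v (n + 1)) \<le> F (\<theta> (n + 1))"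
    "v (n + 1) = closest_point C (\<theta> n + \<alpha>\<^sub>\<theta> *\<^sub>R grad F (\<theta> n))"
proof -
  have eqs: "z (n + 1) = closest_point C (y n + \<alpha>\<^sub>y *\<^sub>R grad F (y n))"
    "v (n + 1) = closest_point C (\<theta> n + \<alpha>\<^sub>\<theta> *\<^sub>R grad F (\<theta> n))"
    "\<theta> (n + 1) = (if F (z (n + 1)) \<ge> F (v (n + 1)) then z (n + 1) else v (n + 1))"
    using apg \<open>n \<ge> 1\<close> unfolding apg_iterates_def by blast+
  show "\<theta> (n + 1) \<in> C" "F (v (n + 1)) \<le> F (\<theta> (n + 1))"
    "v (n + 1) = closest_point C (\<theta> n + \<alpha>\<^sub>\<theta> *\<^sub>R grad F (\<theta> n))"
    using closest_point_in_set[OF C] eqs by auto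
qed

lemma apg_accumulation_point_stationary:
  fixes F :: "real ^ 'k::finite ^ 'm::finite \<Rightarrow> real"
  assumes diff: "\<And>x. F differentiable (at x)" and lip: "L-lipschitz_on UNIV (grad F)"
    and C: "convex C" "compact C" "C \<noteq> {}"
    and \<alpha>: "0 < \<alpha>\<^sub>\<theta>" "\<alpha>\<^sub>\<theta> < 1 / L" and L: "L > 0"
    and apg: "apg_iterates F C \<alpha>\<^sub>\<theta> \<alpha>\<^sub>y \<theta> z y v t"
    and acc: "accumulation_point \<theta> x"
  shows "stationary_max F C x"
proof -
  have clC: "closed C" using C compact_imp_closed by blast
  have inC: "\<theta> n \<in> C" if "n \<ge> 2" for n
    using apg_iterates_step(1)[OF apg clC C(3), of "n - 1"] that by simp
  have v_eq: "v (n + 1) = closest_point C (\<theta> n + \<alpha>\<^sub>\<theta> *\<^sub>R grad F (\<theta> n))" if "n \<ge> 2" for n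
    using apg_iterates_step(3)[OF apg clC C(3), of n] that by simp
  have asc: "F (\<theta> n) + L / 2 * (norm (v (n + 1) - \<theta> n))\<^sup>2 \<le> F (\<theta> (n + 1))" if "n \<ge> 2" for n
    using projected_gradient_ascent[OF diff lip C(1) clC inC[OF that] \<alpha> L v_eq[OF that]]
      apg_iterates_step(2)[OF apg clC C(3), of n] that by simp
  obtain r :: "nat \<Rightarrow> nat" where r: "strict_mono r" "(\<theta> \<circ> r) \<longlonglongrightarrow> x"
    using acc unfolding accumulation_point_def by blast
  have xC: "x \<in> C"
    by (rule accumulation_point_in_closed[OF clC inC r])
  have "continuous_on C F"
    using diff differentiable_imp_continuous_within continuous_at_imp_continuous_on by blast
  then obtain b where b: "\<And>y. y \<in> C \<Longrightarrow> F y \<le> b"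
    using continuous_attains_sup[OF C(2,3)] by blast
  have inc: "incseq (\<lambda>n. F (\<theta> (n + 2)))"
  proof (rule incseq_SucI)
    fix n
    have "0 \<le> L / 2 * (norm (v (n + 3) - \<theta> (n + 2)))\<^sup>2" using L by simp
    then show "F (\<theta> (n + 2)) \<le> F (\<theta> (Suc n + 2))"
      using asc[of "n + 2"] by (simp add: add.commute eval_nat_numeral)
  qed
  obtain l where "(\<lambda>n. F (\<theta> (n + 2))) \<longlonglongrightarrow> l"
    using incseq_convergent[OF inc, of b] b inC by (metis le_add2)
  then have Flim: "(\<lambda>n. F (\<theta> n)) \<longlonglongrightarrow> l" by (rule LIMSEQ_offset)
  then have "(\<lambda>n. 2 / L * (F (\<theta> (n + 1)) - F (\<theta> n))) \<longlonglongrightarrow> 2 / L * (l - l)"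
    by (intro tendsto_intros LIMSEQ_ignore_initial_segment)
  then have "(\<lambda>n. 2 / L * (F (\<theta> (n + 1)) - F (\<theta> n))) \<longlonglongrightarrow> 0" by simp
  then have "(\<lambda>n. (norm (v (n + 1) - \<theta> n))\<^sup>2) \<longlonglongrightarrow> 0"
  proof (rule tendsto_sandwich[OF _ _ tendsto_const, rotated 2])
    have "(norm (v (n + 1) - \<theta> n))\<^sup>2 \<le> 2 / L * (F (\<theta> (n + 1)) - F (\<theta> n))" if "n \<ge> 2" for n
      using asc[OF that] L by (simp add: field_simps)
    then show "\<forall>\<^sub>F n in sequentially. (norm (v (n + 1) - \<theta> n))\<^sup>2 \<le> 2 / L * (F (\<theta> (n + 1)) - F (\<theta> n))"
      unfolding eventually_sequentially by blast
  qed simp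
  then have "(\<lambda>n. v (n + 1) - \<theta> n) \<longlonglongrightarrow> 0"
    using tendsto_real_sqrt[of "\<lambda>n. (norm (v (n + 1) - \<theta> n))\<^sup>2" 0] by (simp add: tendsto_norm_zero_iff)
  then have "((\<lambda>n. v (n + 1) - \<theta> n) \<circ> r) \<longlonglongrightarrow> 0"
    using r(1) by (rule LIMSEQ_subseq_LIMSEQ)
  from tendsto_add[OF this r(2)] have "(\<lambda>n. v (r n + 1)) \<longlonglongrightarrow> x" by (simp add: o_def)
  moreover have "(\<lambda>n. v (r n + 1)) \<longlonglongrightarrow> closest_point C (x + \<alpha>\<^sub>\<theta> *\<^sub>R grad F x)"
  proof -
    have "isCont (grad F) x"
      using lipschitz_on_continuous_on[OF lip] by (simp add: continuous_on_eq_continuous_at)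
    then have "(\<lambda>n. grad F (\<theta> (r n))) \<longlonglongrightarrow> grad F x"
      using r(2) isCont_tendsto_compose by (fastforce simp: o_def)
    then have "(\<lambda>n. \<theta> (r n) + \<alpha>\<^sub>\<theta> *\<^sub>R grad F (\<theta> (r n))) \<longlonglongrightarrow> x + \<alpha>\<^sub>\<theta> *\<^sub>R grad F x"
      using r(2) by (intro tendsto_intros) (auto simp: o_def)
    then have "(\<lambda>n. closest_point C (\<theta> (r n) + \<alpha>\<^sub>\<theta> *\<^sub>R grad F (\<theta> (r n))))
        \<longlonglongrightarrow> closest_point C (x + \<alpha>\<^sub>\<theta> *\<^sub>R grad F x)"
      by (rule isCont_tendsto_compose[OF continuous_at_closest_point[OF C(1) clC C(3)]])
    moreover have "\<forall>\<^sub>F n in sequentially. closest_point C (\<theta> (r n) + \<alpha>\<^sub>\<theta> *\<^sub>R grad F (\<theta> (r n))) = v (r n + 1)"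
      unfolding eventually_sequentially
      using v_eq seq_suble[OF r(1)] order_trans by metis
    ultimately show ?thesis by (rule Lim_transform_eventually)
  qed
  ultimately have "closest_point C (x + \<alpha>\<^sub>\<theta> *\<^sub>R grad F x) = x"
    using LIMSEQ_unique by blast
  then show ?thesis
    by (rule projected_gradient_fixed_imp_stationary_max[OF C(1) clC xC \<alpha>(1) diff])
qed

section \<open>Differentiability of the objective functions\<close>

lemma differentiable_real_compose:
  fixes f :: "'a::real_normed_vector \<Rightarrow> real" and h :: "real \<Rightarrow> real"
  assumes "f differentiable (at x)" "(h has_real_derivative D) (at (f x))"
  shows "(\<lambda>x. h (f x)) differentiable (at x)"
  using differentiable_chain_at[OF assms(1) differentiableI[OF has_field_derivative_imp_has_derivative[OF assms(2)]]]
  by (simp add: o_def)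

lemma has_real_derivative_max_0_power2:
  "((\<lambda>x::real. (max 0 x)\<^sup>2) has_real_derivative 2 * max 0 x) (at x)"
proof -
  consider "x > 0" | "x < 0" | "x = 0" by linarith
  then show ?thesis
  proof cases
    case 1
    have "((\<lambda>x::real. x\<^sup>2) has_real_derivative 2 * max 0 x) (at x)"
      using 1 by (auto intro!: derivative_eq_intros)
    then show ?thesis
      by (rule has_field_derivative_transform_within_open[of _ _ _ "{0<..}"]) (use 1 in auto)
  next
    case 2
    have "((\<lambda>x::real. 0) has_real_derivative 2 * max 0 x) (at x)"
      using 2 by auto
    then show ?thesis
      by (rule has_field_derivative_transform_within_open[of _ _ _ "{..<0}"]) (use 2 in auto)
  next
    case 3
    have "((\<lambda>h::real. (max 0 h)\<^sup>2 / h) \<longlongrightarrow> 0) (at 0)"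
    proof (rule Lim_null_comparison)
      show "\<forall>\<^sub>F h in at 0. norm ((max 0 h)\<^sup>2 / h) \<le> \<bar>h::real\<bar>"
        by (rule always_eventually) (auto simp: max_def power2_eq_square)
      show "((\<lambda>h::real. \<bar>h\<bar>) \<longlongrightarrow> 0) (at 0)"
        by (rule tendsto_eq_intros refl | simp)+
    qed
    then show ?thesis using 3 by (simp add: DERIV_def)
  qed
qed

lemma bounded_linear_Amap: "bounded_linear (Amap k :: real ^ 'k::finite ^ 'm::finite \<Rightarrow> real ^ 'm)"
  unfolding linear_conv_bounded_linear[symmetric]
  by (rule linearI) (auto simp: Amap_def vec_eq_iff)

lemma Amap_differentiable: "Amap k differentiable (at (\<theta> :: real ^ 'k::finite ^ 'm::finite))"
  using bounded_linear_Amap bounded_linear_imp_differentiable by blast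

lemma dfun_ge_1:
  assumes "valid_system D"
  shows "1 \<le> dfun D k \<theta>"
proof -
  have "0 < rhoD D" using assms by (simp add: valid_system_def)
  then show ?thesis
    unfolding dfun_def by (auto intro!: add_nonneg_nonneg mult_nonneg_nonneg sum_nonneg)
qed

lemma differentiable_power2_norm:
  fixes f :: "'a::real_normed_vector \<Rightarrow> 'b::real_inner"
  assumes "f differentiable (at x)"
  shows "(\<lambda>x. (norm (f x))\<^sup>2) differentiable (at x)"
  unfolding power2_norm_eq_inner using assms by (intro differentiable_inner)

lemma vec_mult_differentiable:
  fixes f :: "'a::real_normed_vector \<Rightarrow> real ^ 'n::finite"
  assumes "f differentiable (at x)"
  shows "(\<lambda>x. c * f x) differentiable (at x)"
proof -
  have "linear ((*) c)"
    by (rule linearI) (auto simp: vec_eq_iff algebra_simps)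
  then have "bounded_linear ((*) c)" by (simp add: linear_conv_bounded_linear)
  then show ?thesis
    using differentiable_chain_at[OF assms bounded_linear_imp_differentiable]
    by (fastforce simp: o_def)
qed

lemma dfun_differentiable: "dfun D k differentiable (at \<theta>)"
  unfolding dfun_def
  by (intro differentiable_add differentiable_mult differentiable_sum differentiable_const
      differentiable_power2_norm differentiable_power differentiable_inner vec_mult_differentiable
      Amap_differentiable finite ballI)

lemma ufun_differentiable:
  assumes "valid_system D"
  shows "ufun D k differentiable (at \<theta>)"
proof -
  let ?q = "\<lambda>\<theta>. 1 + rhoD D * (real (nAnt D))\<^sup>2 * (inner (gamma_tilde D k k) (Amap k \<theta>))\<^sup>2 / dfun D k \<theta>"
  have pos: "0 < dfun D k \<theta>" using dfun_ge_1[OF assms, of k \<theta>] by simp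
  have "0 < rhoD D" using assms by (simp add: valid_system_def)
  then have "0 < ?q \<theta>" using pos by (intro add_pos_nonneg) auto
  then have log_deriv: "(log 2 has_real_derivative 1 / (ln 2 * ?q \<theta>)) (at (?q \<theta>))"
    by (auto intro!: derivative_eq_intros)
  have "?q differentiable (at \<theta>)"
    using pos
    by (intro differentiable_add differentiable_mult differentiable_const differentiable_divide
      differentiable_power differentiable_inner dfun_differentiable Amap_differentiable) auto
  then have "(\<lambda>\<theta>. log 2 (?q \<theta>)) differentiable (at \<theta>)"
    using log_deriv by (rule differentiable_real_compose)
  then show ?thesis
    unfolding ufun_def by (intro differentiable_mult differentiable_const)
qed

lemma ffun_differentiable:
  assumes "valid_system D"
  shows "ffun D differentiable (at \<theta>)"
proof -
  have "0 < vfun D \<theta>"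
    unfolding vfun_def using assms
    by (intro add_pos_nonneg mult_nonneg_nonneg sum_nonneg) (auto simp: valid_system_def less_imp_le)
  moreover have "vfun D differentiable (at \<theta>)"
    unfolding vfun_def
    by (intro differentiable_add differentiable_mult differentiable_sum differentiable_const
      differentiable_power2_norm bounded_linear_imp_differentiable[OF bounded_linear_vec_nth] ballI) auto
  ultimately show ?thesis
    unfolding ffun_def
    by (intro differentiable_divide differentiable_mult differentiable_sum differentiable_const
      ufun_differentiable[OF assms] ballI) auto
qed

lemma gfun_differentiable:
  assumes "valid_system D"
  shows "gfun D k differentiable (at \<theta>)"
proof -
  have "0 < dfun D k \<theta>" using dfun_ge_1[OF assms, of k \<theta>] by simp
  then have "(\<lambda>\<theta>. sqrt (dfun D k \<theta>)) differentiable (at \<theta>)"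
    by (rule differentiable_real_compose[OF dfun_differentiable DERIV_real_sqrt])
  then show ?thesis
    unfolding gfun_def
    by (intro differentiable_diff differentiable_mult differentiable_inner differentiable_const
      Amap_differentiable)
qed

lemma f_pen_differentiable:
  assumes "valid_system D"
  shows "f_pen D \<xi> differentiable (at \<theta>)"
proof -
  have "Psi D k differentiable (at \<theta>)" for k
    unfolding Psi_def
    by (rule differentiable_real_compose[OF gfun_differentiable[OF assms] has_real_derivative_max_0_power2])
  then show ?thesis
    unfolding f_pen_def
    by (intro differentiable_diff differentiable_mult differentiable_sum differentiable_const
      ffun_differentiable[OF assms] ballI) auto
qed

section \<open>The constraint sets\<close>

lemma zero_in_Cset: "0 \<in> Cset D"
  by (simp add: Cset_def)

lemma convex_Cset: "convex (Cset (D :: ('m::finite, 'k::finite, 'p::finite) cf_system))"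
proof -
  have "(norm ((u *\<^sub>R x + w *\<^sub>R y) $ m))\<^sup>2 \<le> 1 / real (nAnt D)"
    if "(norm (x $ m))\<^sup>2 \<le> 1 / real (nAnt D)" "(norm (y $ m))\<^sup>2 \<le> 1 / real (nAnt D)"
      "0 \<le> u" "0 \<le> w" "u + w = 1" for x y :: "real ^ 'k ^ 'm" and m u w
  proof -
    have "norm (x $ m) \<le> sqrt (1 / real (nAnt D))" "norm (y $ m) \<le> sqrt (1 / real (nAnt D))"
      using that by (simp_all add: real_le_rsqrt)
    then have "norm (u *\<^sub>R x $ m + w *\<^sub>R y $ m) \<le> sqrt (1 / real (nAnt D))"
      using convexD[OF convex_cball[of 0 "sqrt (1 / real (nAnt D))"], of "x $ m" "y $ m" u w] that
      by simp
    then show ?thesis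
      using sqrt_ge_absD[of "norm (u *\<^sub>R x $ m + w *\<^sub>R y $ m)"] by simp
  qed
  then show ?thesis
    unfolding Cset_def by (auto intro!: convexI)
qed

lemma compact_Cset: "compact (Cset (D :: ('m::finite, 'k::finite, 'p::finite) cf_system))"
proof -
  have "closed (Cset D)"
    unfolding Cset_def
    by (intro closed_Collect_conj closed_Collect_all closed_Collect_le continuous_intros)
  moreover have "bounded (Cset D)"
    unfolding bounded_iff
  proof (intro exI ballI)
    fix \<theta> :: "real ^ 'k ^ 'm" assume "\<theta> \<in> Cset D"
    then have "norm (\<theta> $ m) \<le> sqrt (1 / real (nAnt D))" for m
      by (simp add: Cset_def real_le_rsqrt)
    then have "(\<Sum>m\<in>UNIV. norm (\<theta> $ m)) \<le> (\<Sum>m\<in>(UNIV::'m set). sqrt (1 / real (nAnt D)))"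
      by (rule sum_mono)
    moreover have "norm \<theta> \<le> (\<Sum>m\<in>UNIV. norm (\<theta> $ m))"
      unfolding norm_vec_def[of \<theta>] by (rule L2_set_le_sum) simp
    ultimately show "norm \<theta> \<le> (\<Sum>m\<in>(UNIV::'m set). sqrt (1 / real (nAnt D)))"
      by (rule order_trans[rotated])
  qed
  ultimately show ?thesis by (simp add: compact_eq_bounded_closed)
qed

lemma convex_on_sqrt_add:
  assumes A: "convex_on S (\<lambda>x. sqrt (A x))" and B: "convex_on S (\<lambda>x. sqrt (B x))"
    and nonneg: "\<And>x. 0 \<le> A x" "\<And>x. 0 \<le> B x"
  shows "convex_on S (\<lambda>x. sqrt (A x + B x))"
proof (rule convex_onI)
  show "convex S" using A by (rule convex_on_imp_convex)
  fix t :: real and x y assume t: "0 < t" "t < 1" and xy: "x \<in> S" "y \<in> S"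
  let ?z = "(1 - t) *\<^sub>R x + t *\<^sub>R y"
  have "sqrt (A ?z) \<le> (1 - t) * sqrt (A x) + t * sqrt (A y)"
    "sqrt (B ?z) \<le> (1 - t) * sqrt (B x) + t * sqrt (B y)"
    using convex_onD[OF A] convex_onD[OF B] t xy by auto
  then have "(sqrt (A ?z))\<^sup>2 + (sqrt (B ?z))\<^sup>2 \<le>
    ((1 - t) * sqrt (A x) + t * sqrt (A y))\<^sup>2 + ((1 - t) * sqrt (B x) + t * sqrt (B y))\<^sup>2"
    using nonneg by (intro add_mono power_mono) auto
  then have "sqrt (A ?z + B ?z) \<le>
    sqrt (((1 - t) * sqrt (A x) + t * sqrt (A y))\<^sup>2 + ((1 - t) * sqrt (B x) + t * sqrt (B y))\<^sup>2)"
    using nonneg by simp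
  also have "\<dots> \<le> sqrt (((1 - t) * sqrt (A x))\<^sup>2 + ((1 - t) * sqrt (B x))\<^sup>2)
      + sqrt ((t * sqrt (A y))\<^sup>2 + (t * sqrt (B y))\<^sup>2)"
    by (rule real_sqrt_sum_squares_triangle_ineq)
  also have "\<dots> = sqrt ((1 - t)\<^sup>2 * (A x + B x)) + sqrt (t\<^sup>2 * (A y + B y))"
    using nonneg by (simp add: power_mult_distrib distrib_left)
  also have "\<dots> = (1 - t) * sqrt (A x + B x) + t * sqrt (A y + B y)"
    using t by (simp add: real_sqrt_mult)
  finally show "sqrt (A ?z + B ?z) \<le> (1 - t) * sqrt (A x + B x) + t * sqrt (A y + B y)" .
qed

lemma convex_on_sqrt_sum:
  assumes "finite I" "convex S" "\<And>i. i \<in> I \<Longrightarrow> convex_on S (\<lambda>x. sqrt (A i x))" "\<And>i x. 0 \<le> A i x"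
  shows "convex_on S (\<lambda>x. sqrt (\<Sum>i\<in>I. A i x))"
  using assms
proof (induction I)
  case empty
  then show ?case by (simp add: convex_on_const)
next
  case (insert i I)
  then show ?case
    by (simp add: convex_on_sqrt_add sum_nonneg)
qed

lemma convex_on_norm_linear:
  assumes "linear h" "convex S"
  shows "convex_on S (\<lambda>x. norm (h x))"
proof (rule convex_onI[OF _ assms(2)])
  fix t :: real and x y assume "0 < t" "t < 1"
  then show "norm (h ((1 - t) *\<^sub>R x + t *\<^sub>R y)) \<le> (1 - t) * norm (h x) + t * norm (h y)"
    using norm_triangle_ineq[of "(1 - t) *\<^sub>R h x" "t *\<^sub>R h y"]
    by (simp add: linear_add[OF assms(1)] linear_scale[OF assms(1)])
qed

lemma convex_on_sqrt_dfun:
  fixes D :: "('m::finite, 'k::finite, 'p::finite) cf_system"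
  assumes "valid_system D"
  shows "convex_on UNIV (\<lambda>\<theta>. sqrt (dfun D k \<theta>))"
proof -
  have pos: "0 < rhoD D" using assms by (simp add: valid_system_def)
  have lin: "linear (Amap k' :: real ^ 'k ^ 'm \<Rightarrow> real ^ 'm)" for k' :: 'k
    using bounded_linear_Amap by (rule bounded_linear.linear)
  have 1: "convex_on UNIV (\<lambda>\<theta>. sqrt ((inner (gamma_tilde D k' k) (Amap k' \<theta>))\<^sup>2))" for k'
    using convex_on_norm_linear[of "\<lambda>\<theta>. inner (gamma_tilde D k' k) (Amap k' \<theta>)" UNIV]
      linear_compose[OF lin, of "inner (gamma_tilde D k' k)"]
    by (simp add: o_def bounded_linear.linear[OF bounded_linear_inner_right])
  have "linear ((*) (kappa_tilde D k))"
    by (rule linearI) (auto simp: vec_eq_iff algebra_simps)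
  then have 2: "convex_on UNIV (\<lambda>\<theta>. sqrt ((norm (kappa_tilde D k * Amap k' \<theta>))\<^sup>2))" for k' :: 'k
    using convex_on_norm_linear[of "\<lambda>\<theta>. kappa_tilde D k * Amap k' \<theta>" UNIV]
      linear_compose[OF lin, of "(*) (kappa_tilde D k)"]
    by (simp add: o_def)
  show ?thesis
    unfolding dfun_def
  proof (intro convex_on_sqrt_add)
    show "convex_on UNIV (\<lambda>\<theta>. sqrt (rhoD D * (real (nAnt D))\<^sup>2 *
       (\<Sum>k'\<in>UNIV - {k}. (inner (gamma_tilde D k' k) (Amap k' \<theta>))\<^sup>2)))"
      unfolding real_sqrt_mult[of "rhoD D * (real (nAnt D))\<^sup>2"]
      using pos by (intro convex_on_cmul convex_on_sqrt_sum 1) auto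
    show "convex_on UNIV (\<lambda>\<theta>. sqrt (rhoD D * real (nAnt D) *
       (\<Sum>k'\<in>(UNIV :: 'k set). (norm (kappa_tilde D k * Amap k' \<theta>))\<^sup>2)))"
      unfolding real_sqrt_mult[of "rhoD D * real (nAnt D)"]
      using pos by (intro convex_on_cmul convex_on_sqrt_sum 2) auto
  qed (use pos in \<open>auto intro!: mult_nonneg_nonneg add_nonneg_nonneg sum_nonneg simp: convex_on_const\<close>)
qed

lemma acoef_nonneg:
  assumes "valid_system D"
  shows "0 \<le> acoef D k"
proof -
  have "0 < tauP D" by (simp add: tauP_def)
  then have "0 \<le> seMin D k * tauC D / (tauC D - tauP D)" "0 < rhoD D"
    using assms by (auto simp: valid_system_def)
  then show ?thesis
    unfolding acoef_def by (auto intro!: divide_nonneg_nonneg ge_one_powr_ge_zero)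
qed

lemma convex_on_gfun:
  assumes "valid_system D"
  shows "convex_on UNIV (gfun D k)"
proof -
  have "convex_on UNIV (\<lambda>\<theta>. - inner (gamma_tilde D k k) (Amap k \<theta>))"
    by (rule convex_onI)
      (auto simp: linear_add[OF bounded_linear.linear[OF bounded_linear_Amap]]
        linear_scale[OF bounded_linear.linear[OF bounded_linear_Amap]] inner_add_right)
  from convex_on_add[OF convex_on_cmul[OF acoef_nonneg[OF assms] convex_on_sqrt_dfun[OF assms]] this]
  show ?thesis by (simp add: gfun_def[abs_def])
qed

lemma convex_feasible_P2_conv:
  assumes "valid_system D"
  shows "convex (feasible_P2_conv D)"
proof -
  have "convex {\<theta>. gfun D k \<theta> \<le> 0}" for k
  proof (rule convexI)
    fix x y and u w :: real
    assume "x \<in> {\<theta>. gfun D k \<theta> \<le> 0}" "y \<in> {\<theta>. gfun D k \<theta> \<le> 0}" "0 \<le> u" "0 \<le> w" "u + w = 1"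
    then show "u *\<^sub>R x + w *\<^sub>R y \<in> {\<theta>. gfun D k \<theta> \<le> 0}"
      using convex_lower[OF convex_on_gfun[OF assms], of x y u w k] by fastforce
  qed
  then have "convex (Cset D \<inter> (\<Inter>k. {\<theta>. gfun D k \<theta> \<le> 0}))"
    by (intro convex_Int convex_Cset convex_INT)
  also have "Cset D \<inter> (\<Inter>k. {\<theta>. gfun D k \<theta> \<le> 0}) = feasible_P2_conv D"
    by (auto simp: feasible_P2_conv_def)
  finally show ?thesis .
qed

lemma inner_gamma_tilde_Amap_nonneg:
  assumes "valid_system D" "\<theta> \<in> Cset D"
  shows "0 \<le> inner (gamma_tilde D k k) (Amap k \<theta>)"
proof -
  have pos: "0 < rhoP D" "0 < tauP D" "\<And>m k. 0 < beta D m k"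
    using assms(1) by (auto simp: valid_system_def tauP_def)
  then have "0 \<le> gamma D m k" for m
    unfolding gamma_def
    by (intro divide_nonneg_nonneg mult_nonneg_nonneg add_nonneg_nonneg sum_nonneg)
      (auto simp: less_imp_le)
  then show ?thesis
    unfolding gamma_tilde_def Amap_def inner_vec_def pilot_corr_def
    using assms(2) pos by (auto intro!: sum_nonneg mult_nonneg_nonneg simp: Cset_def less_imp_le)
qed

lemma ufun_ge_seMin_iff:
  assumes D: "valid_system D" and "\<theta> \<in> Cset D"
  shows "seMin D k \<le> ufun D k \<theta> \<longleftrightarrow> gfun D k \<theta> \<le> 0"
proof -
  define q where "q = seMin D k * tauC D / (tauC D - tauP D)"
  define c where "c = rhoD D * (real (nAnt D))\<^sup>2"
  define i where "i = inner (gamma_tilde D k k) (Amap k \<theta>)"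
  define d where "d = dfun D k \<theta>"
  have pos: "0 < tauC D" "0 < tauC D - tauP D" "0 < c" "0 \<le> i" "1 \<le> d"
    using D dfun_ge_1[OF D] inner_gamma_tilde_Amap_nonneg[OF assms]
    by (auto simp: valid_system_def tauP_def c_def i_def d_def intro: order.strict_trans[of 0 "real CARD('c)"])
  have "seMin D k \<le> ufun D k \<theta> \<longleftrightarrow> q \<le> log 2 (1 + c * i\<^sup>2 / d)"
    using pos by (simp add: ufun_def q_def c_def i_def d_def field_simps)
  also have "\<dots> \<longleftrightarrow> 2 powr q \<le> 1 + c * i\<^sup>2 / d"
    using pos by (intro le_log_iff) (auto intro: add_pos_nonneg)
  also have "\<dots> \<longleftrightarrow> (2 powr q - 1) / c * d \<le> i\<^sup>2"
    using pos by (simp add: field_simps)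
  also have "\<dots> \<longleftrightarrow> sqrt ((2 powr q - 1) / c * d) \<le> sqrt (i\<^sup>2)"
    by (simp only: real_sqrt_le_iff)
  also have "\<dots> \<longleftrightarrow> acoef D k * sqrt d \<le> i"
    using pos(4) by (simp add: acoef_def q_def[symmetric] c_def[symmetric] real_sqrt_mult del: times_divide_eq_left)
  finally show ?thesis by (simp add: gfun_def i_def d_def)
qed

lemma feasible_P2_eq:
  assumes "valid_system D"
  shows "feasible_P2 D = feasible_P2_conv D"
  unfolding feasible_P2_def feasible_P2_conv_def using ufun_ge_seMin_iff[OF assms] by blast

section \<open>Limits of penalized maximizers\<close>

lemma continuous_gfun:
  assumes "valid_system D"
  shows "isCont (gfun D k) \<theta>"
  using gfun_differentiable[OF assms] by (rule differentiable_imp_continuous_within)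

lemma continuous_ffun:
  assumes "valid_system D"
  shows "isCont (ffun D) \<theta>"
  using ffun_differentiable[OF assms] by (rule differentiable_imp_continuous_within)

lemma optimal_max_f_pen_lower_bound:
  assumes opt: "optimal_max (f_pen D \<xi>) (Cset D) \<theta>" and y: "y \<in> feasible_P2_conv D"
  shows "ffun D y + \<xi> * (\<Sum>k\<in>UNIV. Psi D k \<theta>) \<le> ffun D \<theta>"
proof -
  have "Psi D k y = 0" for k
    using y by (simp add: feasible_P2_conv_def Psi_def)
  then have "f_pen D \<xi> y = ffun D y" by (simp add: f_pen_def)
  moreover have "f_pen D \<xi> y \<le> f_pen D \<xi> \<theta>"
    using opt y by (auto simp: optimal_max_def feasible_P2_conv_def)
  ultimately have "ffun D y \<le> f_pen D \<xi> \<theta>" by simp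
  then show ?thesis by (simp add: f_pen_def)
qed

lemma penalty_limit_optimal:
  assumes D: "valid_system D" and ne: "feasible_P2_conv D \<noteq> {}"
    and \<xi>: "filterlim \<xi> at_top sequentially"
    and opt: "\<And>j. j \<ge> 1 \<Longrightarrow> optimal_max (f_pen D (\<xi> j)) (Cset D) (\<theta> j)"
    and acc: "accumulation_point \<theta> x"
  shows "optimal_max (ffun D) (feasible_P2_conv D) x"
proof -
  obtain r :: "nat \<Rightarrow> nat" where r: "strict_mono r" "(\<theta> \<circ> r) \<longlonglongrightarrow> x"
    using acc unfolding accumulation_point_def by blast
  have r1: "\<forall>\<^sub>F j in sequentially. 1 \<le> r j"
    using seq_suble[OF r(1)] order_trans unfolding eventually_sequentially by blast
  have \<xi>r: "filterlim (\<lambda>j. \<xi> (r j)) at_top sequentially"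
    using filterlim_compose[OF \<xi> filterlim_subseq[OF r(1)]] .
  have xC: "x \<in> Cset D"
    by (rule accumulation_point_in_closed[OF compact_imp_closed[OF compact_Cset] _ r, of 1])
      (use opt in \<open>auto simp: optimal_max_def\<close>)
  have flim: "(\<lambda>j. ffun D (\<theta> (r j))) \<longlonglongrightarrow> ffun D x"
    using isCont_tendsto_compose[OF continuous_ffun[OF D] r(2)] by (simp add: o_def)
  have Psilim: "(\<lambda>j. \<Sum>k\<in>UNIV. Psi D k (\<theta> (r j))) \<longlonglongrightarrow> (\<Sum>k\<in>UNIV. Psi D k x)"
    unfolding Psi_def
    using isCont_tendsto_compose[OF continuous_gfun[OF D] r(2)]
    by (intro tendsto_intros) (simp add: o_def)
  have Psi_nonneg: "0 \<le> Psi D k \<theta>" for k \<theta> by (simp add: Psi_def)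
  obtain y0 where y0: "y0 \<in> feasible_P2_conv D" using ne by blast
  have "(\<Sum>k\<in>UNIV. Psi D k x) \<le> 0"
  proof (rule tendsto_le[OF _ _ Psilim])
    show "(\<lambda>j. (ffun D (\<theta> (r j)) - ffun D y0) / \<xi> (r j)) \<longlonglongrightarrow> 0"
      by (rule real_tendsto_divide_at_top[OF tendsto_diff[OF flim tendsto_const] \<xi>r])
    have "\<forall>\<^sub>F j in sequentially. 0 < \<xi> (r j)"
      using \<xi>r by (simp add: filterlim_at_top_dense)
    then show "\<forall>\<^sub>F j in sequentially. (\<Sum>k\<in>UNIV. Psi D k (\<theta> (r j))) \<le> (ffun D (\<theta> (r j)) - ffun D y0) / \<xi> (r j)"
      using r1
    proof eventually_elim
      case (elim j)
      then show ?case
        using optimal_max_f_pen_lower_bound[OF opt[OF elim(2)] y0] by (simp add: field_simps)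
    qed
  qed simp
  then have "Psi D k x = 0" for k
    using Psi_nonneg sum_nonneg_eq_0_iff[of UNIV "\<lambda>k. Psi D k x"]
    by (simp add: order_antisym sum_nonneg)
  then have "gfun D k x \<le> 0" for k
    by (metis Psi_def max.cobounded2 power_eq_0_iff)
  then have xF: "x \<in> feasible_P2_conv D" using xC by (simp add: feasible_P2_conv_def)
  have "ffun D y \<le> ffun D x" if y: "y \<in> feasible_P2_conv D" for y
  proof (rule tendsto_lowerbound[OF flim])
    have "\<forall>\<^sub>F j in sequentially. 0 < \<xi> (r j)"
      using \<xi>r by (simp add: filterlim_at_top_dense)
    then show "\<forall>\<^sub>F j in sequentially. ffun D y \<le> ffun D (\<theta> (r j))"
      using r1
    proof eventually_elim
      case (elim j)
      have "0 \<le> \<xi> (r j) * (\<Sum>k\<in>UNIV. Psi D k (\<theta> (r j)))"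
        using elim(1) Psi_nonneg by (simp add: sum_nonneg)
      then show ?case
        using optimal_max_f_pen_lower_bound[OF opt[OF elim(2)] y] by simp
    qed
  qed simp
  then show ?thesis using xF by (simp add: optimal_max_def)
qed

lemma geometric_filterlim_at_top:
  fixes \<xi> :: "nat \<Rightarrow> real"
  assumes "\<xi> 1 > 0" "\<rho> > 1" "\<And>j. j \<ge> 1 \<Longrightarrow> \<xi> (j + 1) = \<rho> * \<xi> j"
  shows "filterlim \<xi> at_top sequentially"
proof -
  have eq: "\<xi> (Suc j) = \<xi> 1 * \<rho> ^ j" for j
    by (induction j) (use assms(3) in auto)
  have "filterlim (\<lambda>j. \<xi> 1 * \<rho> ^ j) at_top sequentially"
    using filterlim_realpow_sequentially_gt1[of \<rho>] assms
    by (intro filterlim_tendsto_pos_mult_at_top[OF tendsto_const]) (auto simp: filterlim_at_infinity_conv_norm_at_top norm_power)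
  then show ?thesis
    unfolding filterlim_sequentially_Suc[of \<xi>, symmetric] eq .
qed

theorem mainTheorem1:
  fixes D :: "('m::finite, 'k::finite, 'p::finite) cf_system"
  assumes "valid_system D"
    and "feasible_P2 D \<noteq> {}"
  shows
    "(\<forall>\<xi> L \<alpha>\<^sub>\<theta> \<alpha>\<^sub>y \<theta> z y v t.
        \<xi> > 0 \<longrightarrow>
        L > 0 \<longrightarrow> L-lipschitz_on UNIV (grad (f_pen D \<xi>)) \<longrightarrow>
        0 < \<alpha>\<^sub>\<theta> \<longrightarrow> \<alpha>\<^sub>\<theta> < 1 / L \<longrightarrow> 0 < \<alpha>\<^sub>y \<longrightarrow> \<alpha>\<^sub>y < 1 / L \<longrightarrow>
        apg_iterates (f_pen D \<xi>) (Cset D) \<alpha>\<^sub>\<theta> \<alpha>\<^sub>y \<theta> z y v t \<longrightarrow>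
          (\<theta> 0 \<in> Cset D \<longrightarrow> (\<forall>n\<ge>1. f_pen D \<xi> (\<theta> n) \<le> f_pen D \<xi> (\<theta> (n + 1)))) \<and>
          (\<forall>n\<ge>2. f_pen D \<xi> (\<theta> n) \<le> f_pen D \<xi> (\<theta> (n + 1))) \<and>
          bounded (\<theta> ` {1..}) \<and>
          (\<exists>\<theta>'. accumulation_point \<theta> \<theta>') \<and>
          (\<forall>\<theta>'. accumulation_point \<theta> \<theta>' \<longrightarrow> stationary_max (f_pen D \<xi>) (Cset D) \<theta>'))
     \<and>
     (\<forall>(\<xi> :: nat \<Rightarrow> real) (\<rho> :: real) (\<theta>\<^sub>\<xi> :: nat \<Rightarrow> real ^ 'k ^ 'm).
        \<xi> 1 > 0 \<longrightarrow> \<rho> > 1 \<longrightarrow> (\<forall>j\<ge>1. \<xi> (j + 1) = \<rho> * \<xi> j) \<longrightarrow>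
        (\<forall>j\<ge>1. optimal_max (f_pen D (\<xi> j)) (Cset D) (\<theta>\<^sub>\<xi> j)) \<longrightarrow>
          (\<exists>\<theta>'. accumulation_point \<theta>\<^sub>\<xi> \<theta>') \<and>
          (\<forall>\<theta>'. accumulation_point \<theta>\<^sub>\<xi> \<theta>' \<longrightarrow>
             \<theta>' \<in> feasible_P2 D \<and> stationary_max (ffun D) (feasible_P2_conv D) \<theta>'))"
proof (intro conjI allI impI)
  fix \<xi> L \<alpha>\<^sub>\<theta> \<alpha>\<^sub>y :: real and \<theta> z y v :: "nat \<Rightarrow> real ^ 'k ^ 'm" and t :: "nat \<Rightarrow> real"
  assume L: "L > 0" and lip: "L-lipschitz_on UNIV (grad (f_pen D \<xi>))"
    and \<alpha>: "0 < \<alpha>\<^sub>\<theta>" "\<alpha>\<^sub>\<theta> < 1 / L"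
    and apg: "apg_iterates (f_pen D \<xi>) (Cset D) \<alpha>\<^sub>\<theta> \<alpha>\<^sub>y \<theta> z y v t"
  have C: "convex (Cset D)" "compact (Cset D)" "closed (Cset D)" "Cset D \<noteq> {}"
    using convex_Cset compact_Cset compact_imp_closed zero_in_Cset by blast+
  note diff = f_pen_differentiable[OF assms(1)]
  note step = apg_iterates_step[OF apg C(3,4)]
  have inC: "\<theta> n \<in> Cset D" if "n \<ge> 2" for n
    using step(1)[of "n - 1"] that by simp
  have mono: "f_pen D \<xi> (\<theta> n) \<le> f_pen D \<xi> (\<theta> (n + 1))" if "n \<ge> 1" "\<theta> n \<in> Cset D" for n
  proof -
    have "0 \<le> L / 2 * (norm (v (n + 1) - \<theta> n))\<^sup>2" using L by simp
    then show ?thesis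
      using projected_gradient_ascent[OF diff lip C(1,3) that(2) \<alpha> L step(3)[OF that(1)]]
        step(2)[OF that(1)] by linarith
  qed
  show "f_pen D \<xi> (\<theta> n) \<le> f_pen D \<xi> (\<theta> (n + 1))" if "n \<ge> 2" for n
    using mono inC that by simp
  show "f_pen D \<xi> (\<theta> n) \<le> f_pen D \<xi> (\<theta> (n + 1))" if "\<theta> 0 \<in> Cset D" "n \<ge> 1" for n
  proof -
    have "\<theta> 1 \<in> Cset D" using apg that(1) by (simp add: apg_iterates_def)
    then have "\<theta> n \<in> Cset D" using inC[of n] that(2) by (cases "n = 1") auto
    then show ?thesis using mono that by blast
  qed
  have "\<theta> ` {1..} \<subseteq> insert (\<theta> 1) (Cset D)"
  proof (rule image_subsetI)
    fix n :: nat assume "n \<in> {1..}"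
    then show "\<theta> n \<in> insert (\<theta> 1) (Cset D)" using inC[of n] by (cases "n = 1") auto
  qed
  then show "bounded (\<theta> ` {1..})"
    using bounded_subset compact_imp_bounded[OF C(2)] bounded_insert by metis
  show "\<exists>\<theta>'. accumulation_point \<theta> \<theta>'"
    by (rule accumulation_point_exists[OF C(2) inC])
  show "stationary_max (f_pen D \<xi>) (Cset D) \<theta>'" if "accumulation_point \<theta> \<theta>'" for \<theta>'
    by (rule apg_accumulation_point_stationary[OF diff lip C(1,2,4) \<alpha> L apg that])
next
  fix \<xi> :: "nat \<Rightarrow> real" and \<rho> :: real and \<theta> :: "nat \<Rightarrow> real ^ 'k ^ 'm"
  assume \<xi>: "\<xi> 1 > 0" "\<rho> > 1" "\<forall>j\<ge>1. \<xi> (j + 1) = \<rho> * \<xi> j"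
    and opt: "\<forall>j\<ge>1. optimal_max (f_pen D (\<xi> j)) (Cset D) (\<theta> j)"
  show "\<exists>\<theta>'. accumulation_point \<theta> \<theta>'"
    by (rule accumulation_point_exists[OF compact_Cset[of D], of 1])
      (use opt in \<open>auto simp: optimal_max_def\<close>)
  fix x assume acc: "accumulation_point \<theta> x"
  have ne: "feasible_P2_conv D \<noteq> {}"
    using assms feasible_P2_eq by blast
  have x: "optimal_max (ffun D) (feasible_P2_conv D) x"
    by (rule penalty_limit_optimal[OF assms(1) ne geometric_filterlim_at_top[of \<xi> \<rho>] _ acc])
      (use \<xi> opt in auto)
  then show "x \<in> feasible_P2 D"
    by (simp add: feasible_P2_eq[OF assms(1)] optimal_max_def)
  show "stationary_max (ffun D) (feasible_P2_conv D) x"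
    by (rule optimal_max_imp_stationary_max[OF convex_feasible_P2_conv[OF assms(1)] x
      ffun_differentiable[OF assms(1)]])
qed

end
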